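(* Fix $r\ge 2$, $M>0$ and $2\le s\le r$. Suppose $H_n\sim\mathsf{H}_{[r]}(n,\boldsymbol B)$, with $\boldsymbol B=(\boldsymbol\beta_2,\ldots,\boldsymbol\beta_r)$ such that $\boldsymbol\beta_{s'}\in\mathcal B_M$ for $2\le s'\le r$. Given $\delta\in(0,1)$ there exists a constant $C>0$ (depending on $M$, $r$ and $\delta$) such that the following holds for estimation in the $L_2$ norm: $$\min_{\hat{\boldsymbol\beta}}\max_{\boldsymbol\beta_s\in\mathcal B_M}\mathbb P\left(\|\hat{\boldsymbol\beta}-\boldsymbol\beta_s\|_2\ge C\sqrt{\frac{1}{n^{s-2}}}\right)\ge 1-\delta.$$ Moreover, for estimation in the $L_\infty$ norm, there exists $n_0\ge 0$ such that for all $n\ge n_0$, $$\min_{\hat{\boldsymbol\beta}}\max_{\boldsymbol\beta_s\in\mathcal B_M}\mathbb P\left(\|\hat{\boldsymbol\beta}-\boldsymbol\beta_s\|_\infty\ge C\sqrt{\frac{\log n}{n^{s-1}}}\right)\ge 1-\delta.$$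
   Context: $[n]=\{1,\ldots,n\}$ and $\binom{[n]}{s}$ is the collection of $s$-element subsets of $[n]$. $\mathcal B_M=\{\boldsymbol x\in\mathbb R^n:\|\boldsymbol x\|_\infty\le M\}$. The $r$-layered hypergraph $\boldsymbol\beta$-model $\mathsf{H}_{[r]}(n,\boldsymbol B)$, with $\boldsymbol\beta_s=(\beta_{s,v})_{v\in[n]}\in\mathbb R^n$, is the random hypergraph on vertex set $[n]$ in which, for every $2\le s\le r$, each hyperedge $\{v_1,\ldots,v_s\}\in\binom{[n]}{s}$ is present independently with probability $\frac{e^{\beta_{s,v_1}+\cdots+\beta_{s,v_s}}}{1+e^{\beta_{s,v_1}+\cdots+\beta_{s,v_s}}}$. The minimum (infimum) is over all estimators $\hat{\boldsymbol\beta}$, i.e. $\mathbb R^n$-valued functions of the observed hypergraph $H_n$, the maximum (supremum) is over the true parameter $\boldsymbol\beta_s$ of layer $s$, and $\mathbb P$ is the law of $H_n$ under the true parameters. The constant $C$ does not depend on $n$. *)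

theory Defs
  imports "HOL-Probability.Probability"
begin

text \<open>
  Since \<open>n\<close> is quantified inside the statement, \<open>\<real>\<^sup>n\<close> is the set of
  functions on \<open>{1..n}\<close>, extended by \<open>undefined\<close> outside \<open>{1..n}\<close>.
\<close>

definition euclid :: "nat \<Rightarrow> (nat \<Rightarrow> real) set" where
  "euclid n = {1..n} \<rightarrow>\<^sub>E UNIV"

definition norm2 :: "nat \<Rightarrow> (nat \<Rightarrow> real) \<Rightarrow> real" where
  "norm2 n x = L2_set x {1..n}"

text \<open>Only meaningful for \<open>n \<ge> 1\<close>: the maximum of the empty set is unspecified.\<close>

definition norm_inf :: "nat \<Rightarrow> (nat \<Rightarrow> real) \<Rightarrow> real" where
  "norm_inf n x = (MAX v\<in>{1..n}. \<bar>x v\<bar>)"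

definition param_box :: "nat \<Rightarrow> real \<Rightarrow> (nat \<Rightarrow> real) set" where
  "param_box n M = {x \<in> euclid n. norm_inf n x \<le> M}"

definition layer :: "nat \<Rightarrow> nat \<Rightarrow> nat set set" where
  "layer n s = {e. e \<subseteq> {1..n} \<and> card e = s}"

definition hyperedges :: "nat \<Rightarrow> nat \<Rightarrow> nat set set" where
  "hyperedges r n = (\<Union>s\<in>{2..r}. layer n s)"

text \<open>
  The parameters are \<open>B :: nat \<Rightarrow> nat \<Rightarrow> real\<close> with \<open>B s v\<close> standing for \<open>\<beta>\<^sub>s\<^sub>,\<^sub>v\<close>;
  only the layers \<open>s \<in> {2..r}\<close> are used.
\<close>

definition edge_prob :: "(nat \<Rightarrow> nat \<Rightarrow> real) \<Rightarrow> nat set \<Rightarrow> real" where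
  "edge_prob B e =
     exp (\<Sum>v\<in>e. B (card e) v) / (1 + exp (\<Sum>v\<in>e. B (card e) v))"

text \<open>
  The law of the layered hypergraph model, a hypergraph being its set of hyperedges:
  \<open>Pi_pmf\<close> draws the edge indicators independently.
\<close>

definition beta_model :: "nat \<Rightarrow> nat \<Rightarrow> (nat \<Rightarrow> nat \<Rightarrow> real) \<Rightarrow> nat set set pmf" where
  "beta_model r n B =
     map_pmf (\<lambda>X. {e \<in> hyperedges r n. X e})
       (Pi_pmf (hyperedges r n) False (\<lambda>e. bernoulli_pmf (edge_prob B e)))"

text \<open>There are finitely many hypergraphs, so measurability imposes nothing on an estimator.\<close>

definition estimators :: "nat \<Rightarrow> nat \<Rightarrow> (nat set set \<Rightarrow> nat \<Rightarrow> real) set" where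
  "estimators r n = Pow (hyperedges r n) \<rightarrow> euclid n"

end

theory Submission
  imports Defs
begin

text \<open>
  Bound the maximal risk below by the average over a finite prior, and compare each model with
  the one having \<open>\<beta>\<^sub>s = 0\<close>. The density \<open>L\<^sub>\<beta>\<close> satisfies
  \<open>E L\<^sub>\<beta>\<^sup>2 \<le> K\<close> with \<open>K = exp (max\<^sub>\<beta> \<Sum>\<^sub>e (\<Sum>\<^sub>v\<^sub>\<in>\<^sub>e \<beta>\<^sub>v)\<^sup>2)\<close>, so if no ball of radius
  \<open>R\<close> carries more than a fraction \<open>\<rho>\<close> of the prior, Cauchy--Schwarz bounds the average
  probability of an error below \<open>R\<close> by \<open>sqrt (K * \<rho>)\<close>. For the Euclidean norm the prior is
  uniform on a grid \<open>\<epsilon> {0,\<dots>,k-1}\<^sup>n\<close> with \<open>\<epsilon>\<close> of order \<open>n\<close> to the power \<open>-(s-1)/2\<close>: then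
  \<open>K \<le> e\<^sup>n\<close> while \<open>\<rho> \<le> (2e/k)\<^sup>n\<close>, and a large \<open>k\<close> settles every \<open>n \<ge> 1\<close> at once. For the
  maximum norm it is uniform on the \<open>n\<close> points with a single nonzero coordinate
  \<open>c * sqrt (ln n / n\<^sup>s\<^sup>-\<^sup>1)\<close>: then \<open>\<rho> \<le> 1/n\<close> and \<open>K \<le> sqrt n\<close>.
\<close>

section \<open>Averaging over a finite prior\<close>

text \<open>If every probability exceeded \<delta>, so would their average. But that average is the
  mean under \<open>Q\<close> of \<open>L i\<close> times the indicator of \<open>A i\<close>, and
  Cauchy--Schwarz in its linearised form separates the second moment of \<open>L i\<close> from the
  overlap count of the events.\<close>

lemma exists_prob_le_second_moment:
  fixes P :: "'i \<Rightarrow> 'a pmf" and Q :: "'a pmf" and L :: "'i \<Rightarrow> 'a \<Rightarrow> real"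
  assumes "finite I" "I \<noteq> {}" and fin: "finite (set_pmf Q)"
    and dens: "\<And>i x. i \<in> I \<Longrightarrow> pmf (P i) x = pmf Q x * L i x"
    and moment: "\<And>i. i \<in> I \<Longrightarrow> measure_pmf.expectation Q (\<lambda>x. (L i x)\<^sup>2) \<le> K"
    and count: "\<And>x. real (card {i \<in> I. x \<in> A i}) \<le> \<rho> * real (card I)"
    and "K > 0" "\<delta> > 0" and K\<rho>: "K * \<rho> \<le> \<delta>\<^sup>2"
  shows "\<exists>i\<in>I. measure_pmf.prob (P i) (A i) \<le> \<delta>"
proof -
  define S where "S = set_pmf Q"
  \<comment> \<open>This weight makes the moment term \<delta>/2 and the overlap term
    \<open>K * \<rho> / (2 * \<delta>)\<close>, which is at most \<delta>/2 as well.\<close>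
  define \<eta> where "\<eta> = \<delta> / K"
  have \<eta>: "\<eta> > 0" using assms by (simp add: \<eta>_def)
  have finS: "finite S" using fin by (simp add: S_def)
  \<comment> \<open>Here \<open>c\<close> is an indicator value, so it equals its own
    square.\<close>
  have amgm: "l * c \<le> \<eta> / 2 * l\<^sup>2 + c / (2 * \<eta>)" if "c \<in> {0, 1}" for l c :: real
  proof -
    have "0 \<le> (\<eta> * l - c)\<^sup>2" by simp
    also have "\<dots> = 2 * \<eta> * (\<eta> / 2 * l\<^sup>2 + c / (2 * \<eta>) - l * c)"
      using that \<eta> by (auto simp: power2_eq_square field_simps)
    finally show ?thesis using \<eta> by (simp add: zero_le_mult_iff)
  qed
  have prob: "measure_pmf.prob (P i) (A i)
      \<le> \<eta> / 2 * K + (\<Sum>x\<in>S. pmf Q x * indicator (A i) x) / (2 * \<eta>)" if i: "i \<in> I" for i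
  proof -
    have sub: "set_pmf (P i) \<subseteq> S"
      using dens[OF i] by (auto simp: S_def set_pmf_iff)
    have "measure_pmf.prob (P i) (A i) = measure_pmf.expectation (P i) (indicator (A i))"
      by simp
    also have "\<dots> = (\<Sum>x\<in>S. indicator (A i) x * pmf (P i) x)"
      using sub finS by (subst integral_measure_pmf_real[of S]) auto
    also have "\<dots> = (\<Sum>x\<in>S. pmf Q x * (L i x * indicator (A i) x))"
      by (simp add: dens[OF i] mult_ac)
    also have "\<dots> \<le> (\<Sum>x\<in>S. pmf Q x * (\<eta> / 2 * (L i x)\<^sup>2 + indicator (A i) x / (2 * \<eta>)))"
      by (intro sum_mono mult_left_mono amgm) (auto simp: indicator_def)
    also have "\<dots> = \<eta> / 2 * (\<Sum>x\<in>S. (L i x)\<^sup>2 * pmf Q x)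
        + (\<Sum>x\<in>S. pmf Q x * indicator (A i) x) / (2 * \<eta>)"
      by (simp add: distrib_left sum.distrib sum_distrib_left sum_divide_distrib mult_ac)
    also have "(\<Sum>x\<in>S. (L i x)\<^sup>2 * pmf Q x) = measure_pmf.expectation Q (\<lambda>x. (L i x)\<^sup>2)"
      using finS by (subst integral_measure_pmf_real[of S]) (auto simp: S_def)
    also have "\<eta> / 2 * \<dots> \<le> \<eta> / 2 * K"
      using moment[OF i] \<eta> by (intro mult_left_mono) auto
    finally show ?thesis by simp
  qed
  have hits: "(\<Sum>i\<in>I. \<Sum>x\<in>S. pmf Q x * indicator (A i) x) \<le> \<rho> * card I"
  proof -
    have "(\<Sum>i\<in>I. \<Sum>x\<in>S. pmf Q x * indicator (A i) x)
        = (\<Sum>x\<in>S. pmf Q x * (\<Sum>i\<in>I. indicator (A i) x))"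
      by (subst sum.swap) (simp add: sum_distrib_left)
    also have "\<dots> = (\<Sum>x\<in>S. pmf Q x * card {i \<in> I. x \<in> A i})"
    proof (intro sum.cong refl)
      fix x
      have "(\<Sum>i\<in>I. indicator (A i) x :: real) = (\<Sum>i\<in>I. if x \<in> A i then 1 else 0)"
        by (intro sum.cong) (auto simp: indicator_def)
      also have "\<dots> = card {i \<in> I. x \<in> A i}"
        using \<open>finite I\<close> by (simp add: sum.If_cases Int_def)
      finally show "pmf Q x * (\<Sum>i\<in>I. indicator (A i) x) = pmf Q x * card {i \<in> I. x \<in> A i}"
        by simp
    qed
    also have "\<dots> \<le> (\<Sum>x\<in>S. pmf Q x * (\<rho> * card I))"
      by (intro sum_mono mult_left_mono count) auto
    also have "\<dots> = \<rho> * card I"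
      using sum_pmf_eq_1[OF finS, of Q] by (simp add: S_def flip: sum_distrib_right)
    finally show ?thesis .
  qed
  show ?thesis
  proof (rule ccontr)
    assume "\<not> ?thesis"
    then have "(\<Sum>i\<in>I. \<delta>) < (\<Sum>i\<in>I. measure_pmf.prob (P i) (A i))"
      using assms(1,2) by (intro sum_strict_mono) auto
    also have "\<dots> \<le> (\<Sum>i\<in>I. \<eta> / 2 * K + (\<Sum>x\<in>S. pmf Q x * indicator (A i) x) / (2 * \<eta>))"
      by (intro sum_mono prob)
    also have "\<dots> = card I * (\<eta> / 2 * K)
        + (\<Sum>i\<in>I. \<Sum>x\<in>S. pmf Q x * indicator (A i) x) / (2 * \<eta>)"
      by (simp add: sum.distrib sum_divide_distrib)
    also have "\<dots> \<le> card I * (\<eta> / 2 * K) + \<rho> * card I / (2 * \<eta>)"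
      using hits \<eta> by (intro add_left_mono divide_right_mono) auto
    also have "\<dots> = card I * (\<delta> / 2 + K * \<rho> / (2 * \<delta>))"
      using assms by (simp add: \<eta>_def field_simps)
    also have "\<dots> \<le> card I * (\<delta> / 2 + \<delta>\<^sup>2 / (2 * \<delta>))"
      using K\<rho> assms by (intro mult_left_mono add_left_mono divide_right_mono) auto
    also have "\<dots> = (\<Sum>i\<in>I. \<delta>)"
      using assms by (simp add: power2_eq_square)
    finally show False by simp
  qed
qed

section \<open>Edge probabilities and edge counts\<close>

text \<open>The squared quantity is tanh(t/2), the bias of an edge whose parameters sum to
  \<open>t\<close>. The bound makes the second moment quadratic in the parameters; it follows from 1
  + x \<le> exp x, at x = -t for t \<ge> 0 and at x = t otherwise.\<close>

lemma square_logistic_le: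
  fixes t :: real
  shows "(2 * (exp t / (1 + exp t)) - 1)\<^sup>2 \<le> t\<^sup>2"
proof -
  have pos: "0 < 1 + exp t" by (simp add: add_pos_pos)
  have eq: "2 * (exp t / (1 + exp t)) - 1 = (exp t - 1) / (1 + exp t)"
    using pos by (simp add: field_simps)
  have "\<bar>exp t - 1\<bar> \<le> \<bar>t\<bar> * (1 + exp t)"
  proof (cases "t \<ge> 0")
    case True
    have "(1 - t) * exp t \<le> exp (-t) * exp t"
      using exp_ge_add_one_self[of "-t"] by (intro mult_right_mono) auto
    then have "exp t - 1 \<le> t * exp t"
      by (simp add: algebra_simps flip: exp_add)
    then show ?thesis using True by (simp add: algebra_simps)
  next
    case False
    then have "1 - exp t \<le> -t" using exp_ge_add_one_self[of t] by linarith
    moreover have "0 \<le> -t * exp t" using False by (intro mult_nonneg_nonneg) auto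
    ultimately have "1 - exp t \<le> -t + -t * exp t" by linarith
    also have "\<dots> = \<bar>t\<bar> * (1 + exp t)" using False by (simp add: algebra_simps)
    finally show ?thesis using False by simp
  qed
  then have "\<bar>(exp t - 1) / (1 + exp t)\<bar> \<le> \<bar>t\<bar>"
    using pos by (simp add: abs_div divide_le_eq)
  then show ?thesis
    unfolding eq by (simp only: abs_le_square_iff)
qed

lemma edge_prob_bounds: "0 < edge_prob B e" "edge_prob B e < 1"
  by (auto simp: edge_prob_def add_pos_pos)

lemma finite_layer [simp]: "finite (layer n s)"
  by (rule finite_subset[of _ "Pow {1..n}"]) (auto simp: layer_def)

lemma finite_hyperedges [simp]: "finite (hyperedges r n)"
  by (simp add: hyperedges_def)

lemma card_layer_le: "card (layer n s) \<le> n ^ s"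
proof -
  have "card (layer n s) = n choose s"
    using n_subsets[of "{1..n}" s] by (simp add: layer_def)
  also have "\<dots> \<le> n ^ s"
    by (cases "s \<le> n") (auto simp: binomial_le_pow binomial_eq_0)
  finally show ?thesis .
qed

text \<open>A parameter with one nonzero coordinate affects only the edges through that vertex,
  which saves a factor \<open>n\<close> over \<open>card_layer_le\<close>.\<close>

lemma card_layer_containing_le:
  assumes "s \<ge> 1"
  shows "card {e \<in> layer n s. j \<in> e} \<le> n ^ (s - 1)"
proof -
  have "inj_on (\<lambda>e. e - {j}) {e \<in> layer n s. j \<in> e}"
    by (auto simp: inj_on_def)
  moreover have "(\<lambda>e. e - {j}) ` {e \<in> layer n s. j \<in> e} \<subseteq> layer n (s - 1)"
    by (auto simp: layer_def)
  ultimately have "card {e \<in> layer n s. j \<in> e} \<le> card (layer n (s - 1))"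
    by (intro card_inj_on_le) auto
  then show ?thesis using card_layer_le[of n "s - 1"] by linarith
qed

section \<open>Reduction of the minimax risk to a finite prior\<close>

lemma param_boxI:
  assumes "n \<ge> 1" "\<And>v. v \<in> {1..n} \<Longrightarrow> \<bar>f v\<bar> \<le> M"
  shows "restrict f {1..n} \<in> param_box n M"
  using assms by (auto simp: param_box_def norm_inf_def euclid_def)

text \<open>The reference measure has \<open>\<beta>\<^sub>s = 0\<close>, so that its layer-\<open>s\<close> edges are fair coins and
  contribute \<open>1 + (2p - 1)\<^sup>2\<close> to the second moment of the density.\<close>

lemma bernoulli_density_second_moment:
  fixes p q :: real
  assumes "0 < p" "p < 1" "0 < q" "q < 1" "p = q \<or> q = 1 / 2"
  shows "measure_pmf.expectation (bernoulli_pmf q)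
      (\<lambda>b. (pmf (bernoulli_pmf p) b / pmf (bernoulli_pmf q) b)\<^sup>2)
    = 1 + (if p = q then 0 else (2 * p - 1)\<^sup>2)"
proof (cases "p = q")
  case True
  then show ?thesis using assms by simp
next
  case False
  then have q: "q = 1 / 2" using assms(5) by simp
  show ?thesis
    using assms(1-4) False unfolding q by (simp add: power2_eq_square field_simps)
qed

text \<open>Two checks on a prior suffice: bounded energy, and few prior points near any one
  \<open>t\<close>. The other layers of \<open>B\<close> have the same law under the reference and
  the alternatives, so they contribute a factor 1 to the density.\<close>

lemma minimax_risk_ge:
  fixes N :: "(nat \<Rightarrow> real) \<Rightarrow> real"
  assumes s: "s \<in> {2..r}" and I: "finite I" "I \<noteq> {}"
    and box: "\<And>i. i \<in> I \<Longrightarrow> b i \<in> param_box n M"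
    and energy: "\<And>i. i \<in> I \<Longrightarrow> (\<Sum>e\<in>layer n s. (\<Sum>v\<in>e. b i v)\<^sup>2) \<le> \<kappa>"
    and count: "\<And>t. real (card {i \<in> I. N (\<lambda>v. t v - b i v) < R}) \<le> \<rho> * real (card I)"
    and small: "exp \<kappa> * \<rho> \<le> \<delta>\<^sup>2" and \<delta>: "0 < \<delta>"
  shows "(INF est\<in>estimators r n. SUP \<beta>\<in>param_box n M.
      measure_pmf.prob (beta_model r n (B(s := \<beta>))) {H. N (\<lambda>v. est H v - \<beta> v) \<ge> R}) \<ge> 1 - \<delta>"
proof (rule cINF_greatest)
  \<comment> \<open>An infimum of reals is bounded below this way only over a nonempty set.\<close>
  show "estimators r n \<noteq> {}"
    by (auto simp: estimators_def euclid_def Pi_eq_empty PiE_eq_empty_iff)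
next
  fix est
  define E where "E = hyperedges r n"
  define G where "G X = {e \<in> E. X e}" for X :: "nat set \<Rightarrow> bool"
  define p where "p \<beta> = edge_prob (B(s := \<beta>))" for \<beta>
  define q where "q = edge_prob (B(s := (\<lambda>_. 0)))"
  define P where "P \<beta> = Pi_pmf E False (\<lambda>e. bernoulli_pmf (p \<beta> e))" for \<beta>
  define Q where "Q = Pi_pmf E False (\<lambda>e. bernoulli_pmf (q e))"
  define l where "l \<beta> e c = pmf (bernoulli_pmf (p \<beta> e)) c / pmf (bernoulli_pmf (q e)) c" for \<beta> e c
  define L where "L \<beta> X = (\<Prod>e\<in>E. l \<beta> e (X e))" for \<beta> X
  define A where "A \<beta> = {X. N (\<lambda>v. est (G X) v - \<beta> v) < R}" for \<beta>
  have finE: "finite E" by (simp add: E_def)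
  have p01: "0 < p \<beta> e" "p \<beta> e < 1" and q01: "0 < q e" "q e < 1" for \<beta> e
    by (auto simp: p_def q_def edge_prob_bounds)
  \<comment> \<open>The reference charges every outcome, so the quotient \<open>l\<close> is a
    genuine density.\<close>
  have qpos: "pmf (bernoulli_pmf (q e)) c > 0" for e c
    using q01[of e] by (cases c) auto
  have set_Q: "finite (set_pmf Q)"
    unfolding Q_def by (subst set_Pi_pmf) (auto simp: finE intro!: finite_PiE_dflt)
  have dens: "pmf (P \<beta>) X = pmf Q X * L \<beta> X" for \<beta> X
    unfolding P_def Q_def L_def
    using qpos by (auto simp: pmf_Pi finE l_def prod.distrib[symmetric] less_imp_neq[symmetric]
        simp del: pmf_bernoulli_True pmf_bernoulli_False)
  have moment: "measure_pmf.expectation Q (\<lambda>X. (L (b i) X)\<^sup>2) \<le> exp \<kappa>" if i: "i \<in> I" for i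
  proof -
    let ?\<beta> = "b i"
    have "measure_pmf.expectation Q (\<lambda>X. (L ?\<beta> X)\<^sup>2)
        = measure_pmf.expectation Q (\<lambda>X. \<Prod>e\<in>E. (l ?\<beta> e (X e))\<^sup>2)"
      by (simp add: L_def prod_power_distrib)
    also have "\<dots> = (\<Prod>e\<in>E. measure_pmf.expectation (bernoulli_pmf (q e)) (\<lambda>c. (l ?\<beta> e c)\<^sup>2))"
      unfolding Q_def
      by (rule expectation_prod_Pi_pmf) (auto simp: finE intro!: integrable_measure_pmf_finite)
    also have "\<dots> \<le> (\<Prod>e\<in>E. exp (if e \<in> layer n s then (\<Sum>v\<in>e. ?\<beta> v)\<^sup>2 else 0))"
    proof (rule prod_mono)
      fix e assume e: "e \<in> E"
      have *: "card e = s \<longleftrightarrow> e \<in> layer n s"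
        using e by (auto simp: E_def hyperedges_def layer_def)
      \<comment> \<open>Outside layer \<open>s\<close> the two parameters agree; inside it the zero
        parameter gives a fair coin.\<close>
      have eq: "p ?\<beta> e = q e \<or> q e = 1 / 2"
        by (auto simp: p_def q_def edge_prob_def)
      have "measure_pmf.expectation (bernoulli_pmf (q e)) (\<lambda>c. (l ?\<beta> e c)\<^sup>2)
          = 1 + (if p ?\<beta> e = q e then 0 else (2 * p ?\<beta> e - 1)\<^sup>2)"
        unfolding l_def by (rule bernoulli_density_second_moment) (use p01 q01 eq in auto)
      also have "\<dots> \<le> 1 + (if e \<in> layer n s then (\<Sum>v\<in>e. ?\<beta> v)\<^sup>2 else 0)"
        using square_logistic_le[of "\<Sum>v\<in>e. ?\<beta> v"]
        by (auto simp: p_def q_def edge_prob_def simp flip: *)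
      also have "\<dots> \<le> exp (if e \<in> layer n s then (\<Sum>v\<in>e. ?\<beta> v)\<^sup>2 else 0)"
        by (rule exp_ge_add_one_self)
      finally show "0 \<le> measure_pmf.expectation (bernoulli_pmf (q e)) (\<lambda>c. (l ?\<beta> e c)\<^sup>2) \<and>
          measure_pmf.expectation (bernoulli_pmf (q e)) (\<lambda>c. (l ?\<beta> e c)\<^sup>2)
          \<le> exp (if e \<in> layer n s then (\<Sum>v\<in>e. ?\<beta> v)\<^sup>2 else 0)"
        by (simp add: Bochner_Integration.integral_nonneg del: integral_bernoulli_pmf)
    qed
    also have "\<dots> = exp (\<Sum>e\<in>layer n s. (\<Sum>v\<in>e. ?\<beta> v)\<^sup>2)"
    proof -
      have "layer n s \<subseteq> E" using s by (auto simp: E_def hyperedges_def)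
      then show ?thesis
        by (simp add: exp_sum[symmetric] finE sum.If_cases Int_absorb1)
    qed
    also have "\<dots> \<le> exp \<kappa>" using energy[OF i] by simp
    finally show ?thesis .
  qed
  have "\<exists>i\<in>I. measure_pmf.prob (P (b i)) (A (b i)) \<le> \<delta>"
  proof (rule exists_prob_le_second_moment[where L = "\<lambda>i. L (b i)" and K = "exp \<kappa>" and \<rho> = \<rho>])
    \<comment> \<open>The outcome fixes the estimate, so the prior points estimated well there are
      those near the single point \<open>est (G X)\<close>.\<close>
    show "real (card {i \<in> I. X \<in> A (b i)}) \<le> \<rho> * real (card I)" for X
      using count[of "est (G X)"] by (simp add: A_def)
  qed (use I set_Q dens moment \<delta> small in auto)
  then obtain i where i: "i \<in> I" and le: "measure_pmf.prob (P (b i)) (A (b i)) \<le> \<delta>" by blast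
  let ?f = "\<lambda>\<beta>. measure_pmf.prob (beta_model r n (B(s := \<beta>))) {H. N (\<lambda>v. est H v - \<beta> v) \<ge> R}"
  have "?f (b i) = measure_pmf.prob (P (b i)) (- A (b i))"
    unfolding beta_model_def P_def p_def A_def G_def E_def measure_map_pmf
    by (rule arg_cong[where f = "measure_pmf.prob _"]) (auto simp: not_less)
  also have "\<dots> = 1 - measure_pmf.prob (P (b i)) (A (b i))"
    using measure_pmf.prob_compl[of "A (b i)" "P (b i)"] by (simp add: Compl_eq_Diff_UNIV)
  finally have "1 - \<delta> \<le> ?f (b i)" using le by simp
  also have "\<dots> \<le> (SUP \<beta>\<in>param_box n M. ?f \<beta>)"
    by (intro cSUP_upper box i bdd_aboveI2[where M = 1] measure_pmf.prob_le_1)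
  finally show "1 - \<delta> \<le> (SUP \<beta>\<in>param_box n M. ?f \<beta>)" .
qed

section \<open>The Euclidean norm\<close>

text \<open>At most one integer is closer than 1/2 to \<open>u\<close>, and its term is at most
  \<open>exp 1\<close>. The rate \<open>4 * k\<close> gives every other term at most
  \<open>exp (1 - k)\<close>, hence at most \<open>exp 1 / k\<close>, and there are at most
  \<open>k\<close> of these.\<close>

lemma sum_gaussian_grid_le:
  fixes u :: real
  assumes "k \<ge> 1"
  shows "(\<Sum>j<k. exp (1 - 4 * real k * (u - real j)\<^sup>2)) \<le> 2 * exp 1"
proof -
  define J where "J = {j \<in> {..<k}. \<bar>u - real j\<bar> < 1 / 2}"
  have "j = j'" if "j \<in> J" "j' \<in> J" for j j'
  proof -
    have "\<bar>u - real j\<bar> < 1 / 2" "\<bar>u - real j'\<bar> < 1 / 2" using that by (auto simp: J_def)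
    then have "real j < real (j' + 1)" "real j' < real (j + 1)"
      unfolding of_nat_add of_nat_1 by linarith+
    then show ?thesis by linarith
  qed
  then have "card J \<le> 1"
    by (intro card_le_Suc0_iff_eq[THEN iffD2, simplified One_nat_def[symmetric]]) (auto simp: J_def)
  have far: "exp (1 - 4 * real k * (u - real j)\<^sup>2) \<le> exp 1 / k" if "j \<in> {..<k} - J" for j
  proof -
    have "\<bar>1 / 2\<bar> \<le> \<bar>u - real j\<bar>" using that by (auto simp: J_def)
    then have "(1 / 2)\<^sup>2 \<le> (u - real j)\<^sup>2" by (simp only: abs_le_square_iff)
    then have "real k * 1 \<le> real k * (4 * (u - real j)\<^sup>2)"
      by (intro mult_left_mono) (auto simp: power2_eq_square)
    then have "exp (1 - 4 * real k * (u - real j)\<^sup>2) \<le> exp (1 - real k)"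
      by (simp add: mult_ac)
    also have "\<dots> = exp 1 / exp (real k)" by (simp add: exp_diff)
    also have "\<dots> \<le> exp 1 / k"
    proof (rule divide_left_mono)
      show "real k \<le> exp (real k)" using exp_ge_add_one_self[of "real k"] by linarith
    qed (use assms in auto)
    finally show ?thesis .
  qed
  have "(\<Sum>j<k. exp (1 - 4 * real k * (u - real j)\<^sup>2))
      = (\<Sum>j\<in>{..<k} - J. exp (1 - 4 * real k * (u - real j)\<^sup>2))
        + (\<Sum>j\<in>J. exp (1 - 4 * real k * (u - real j)\<^sup>2))"
    by (rule sum.subset_diff) (auto simp: J_def)
  also have "\<dots> \<le> (\<Sum>j\<in>{..<k} - J. exp 1 / k) + (\<Sum>j\<in>J. exp 1)"
    by (intro add_mono sum_mono far) auto
  also have "\<dots> \<le> k * (exp 1 / k) + 1 * exp 1"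
  proof -
    have "real (card ({..<k} - J)) \<le> k" 
      using card_mono[of "{..<k}" "{..<k} - J"] by simp
    then show ?thesis using \<open>card J \<le> 1\<close>
      by (simp only: sum_constant) (intro add_mono mult_right_mono, auto)
  qed
  finally show ?thesis using assms by simp
qed

text \<open>Chernoff bound: a grid point of the ball has \<open>\<Sum>\<^sub>v (1 - 4k(u\<^sub>v - x\<^sub>v)\<^sup>2) \<ge> 0\<close>, and the
  exponential of this sum factorises over the coordinates.\<close>

lemma card_grid_ball_le:
  fixes t :: "nat \<Rightarrow> real"
  assumes k: "k \<ge> 1" and "\<epsilon> > 0"
  shows "real (card {x \<in> {1..n} \<rightarrow>\<^sub>E {..<k}.
      norm2 n (\<lambda>v. t v - \<epsilon> * real (x v)) < \<epsilon> * sqrt (n / (4 * real k))}) \<le> (2 * exp 1) ^ n"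
    (is "real (card ?S) \<le> _")
proof -
  define u where "u v = t v / \<epsilon>" for v
  define g where "g v j = exp (1 - 4 * real k * (u v - real j)\<^sup>2)" for v j
  have fin: "finite ({1..n} \<rightarrow>\<^sub>E {..<k})" by (intro finite_PiE) auto
  have one: "1 \<le> (\<Prod>v\<in>{1..n}. g v (x v))" if "x \<in> ?S" for x
  proof -
    have eq: "t v - \<epsilon> * real (x v) = \<epsilon> * (u v - real (x v))" for v
      using \<open>\<epsilon> > 0\<close> by (simp add: u_def field_simps)
    have "\<epsilon> * L2_set (\<lambda>v. u v - real (x v)) {1..n} < \<epsilon> * sqrt (n / (4 * real k))"
      using that \<open>\<epsilon> > 0\<close> by (simp add: norm2_def eq L2_set_right_distrib)
    then have "(\<Sum>v\<in>{1..n}. (u v - real (x v))\<^sup>2) < n / (4 * real k)"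
      using \<open>\<epsilon> > 0\<close> by (simp add: L2_set_def)
    then have "4 * real k * (\<Sum>v\<in>{1..n}. (u v - real (x v))\<^sup>2) < n"
      using k by (simp add: field_simps)
    then have "0 \<le> (\<Sum>v\<in>{1..n}. 1 - 4 * real k * (u v - real (x v))\<^sup>2)"
      by (simp add: sum_subtractf sum_distrib_left)
    then show ?thesis by (simp add: g_def flip: exp_sum)
  qed
  have "real (card ?S) = (\<Sum>x\<in>?S. 1)" by simp
  also have "\<dots> \<le> (\<Sum>x\<in>?S. \<Prod>v\<in>{1..n}. g v (x v))"
    by (intro sum_mono one)
  \<comment> \<open>Passing from the ball to the whole grid gives a product index set, over which
    the sum factorises.\<close>
  also have "\<dots> \<le> (\<Sum>x\<in>{1..n} \<rightarrow>\<^sub>E {..<k}. \<Prod>v\<in>{1..n}. g v (x v))"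
    by (intro sum_mono2 fin prod_nonneg) (auto simp: g_def)
  also have "\<dots> = (\<Prod>v\<in>{1..n}. \<Sum>j<k. g v j)"
    by (rule prod_sum_PiE[symmetric]) auto
  also have "\<dots> \<le> (\<Prod>v\<in>{1..n}. 2 * exp 1)"
    unfolding g_def using sum_gaussian_grid_le[OF k]
    by (intro prod_mono conjI sum_nonneg) auto
  finally show ?thesis by simp
qed

text \<open>The size of \<open>k\<close> beats the second moment, \<open>a * k \<le> M\<close> keeps
  the grid in the box, and \<open>a * k * r \<le> 1\<close> keeps the energy at most
  \<open>n\<close>.\<close>

lemma minimax_norm2_ge:
  assumes s: "s \<in> {2..r}" and n: "n \<ge> 1" and \<delta>: "0 < \<delta>" "\<delta> < 1"
    and k: "real k \<ge> 2 * (exp 1)\<^sup>2 / \<delta>\<^sup>2" and a: "0 < a" "a * k \<le> M" "a * k * r \<le> 1"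
    and R: "R \<le> a / sqrt (4 * real k) * sqrt (1 / real n ^ (s - 2))"
  shows "(INF est\<in>estimators r n. SUP \<beta>\<in>param_box n M.
      measure_pmf.prob (beta_model r n (B(s := \<beta>))) {H. norm2 n (\<lambda>v. est H v - \<beta> v) \<ge> R}) \<ge> 1 - \<delta>"
proof -
  \<comment> \<open>At most \<open>n ^ s\<close> edges, each of energy at most
    \<open>(r * \<epsilon> * k)\<^sup>2\<close>, then give total energy at most
    \<open>n * (a * k * r)\<^sup>2\<close>.\<close>
  define \<epsilon> where "\<epsilon> = a / sqrt (real n ^ (s - 1))"
  define I where "I = {1..n} \<rightarrow>\<^sub>E {..<k}"
  define b where "b x = restrict (\<lambda>v. \<epsilon> * real (x v)) {1..n}" for x :: "nat \<Rightarrow> nat"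
  have "0 < 2 * (exp 1)\<^sup>2 / \<delta>\<^sup>2" using \<delta> by simp
  with k have k1: "k \<ge> 1" by (cases k) auto
  have \<epsilon>: "\<epsilon> > 0" using a n by (simp add: \<epsilon>_def)
  have \<epsilon>a: "\<epsilon> \<le> a" using a n by (simp add: \<epsilon>_def divide_le_eq)
  \<comment> \<open>As \<open>s\<close> is at least 2, the factor \<open>sqrt n\<close> in the
    radius of the ball cancels exactly one power of \<open>n\<close> under the root.\<close>
  have "s - 1 = Suc (s - 2)" using s by auto
  then have \<epsilon>R: "a / sqrt (4 * real k) * sqrt (1 / real n ^ (s - 2)) = \<epsilon> * sqrt (n / (4 * real k))"
    using n by (simp add: \<epsilon>_def real_sqrt_mult real_sqrt_divide field_simps)
  have coord: "0 \<le> \<epsilon> * real (x v)" "\<epsilon> * real (x v) \<le> \<epsilon> * k" if "x \<in> I" "v \<in> {1..n}" for x v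
    using PiE_mem[OF that[unfolded I_def]] \<epsilon> by auto
  have cardI: "card I = k ^ n" by (simp add: I_def card_PiE)
  show ?thesis
  proof (rule minimax_risk_ge[OF s, where I = I and b = b and \<kappa> = "real n"
        and \<rho> = "(2 * exp 1) ^ n / real k ^ n"])
    show "finite I" by (auto simp: I_def intro: finite_PiE)
    show "I \<noteq> {}" using cardI k1 by auto
    show "b x \<in> param_box n M" if "x \<in> I" for x
      unfolding b_def
    proof (rule param_boxI[OF n])
      fix v assume "v \<in> {1..n}"
      have "\<epsilon> * k \<le> a * k" using \<epsilon>a by (intro mult_right_mono) auto
      then show "\<bar>\<epsilon> * real (x v)\<bar> \<le> M"
        using coord[OF that \<open>v \<in> {1..n}\<close>] a by linarith
    qed
    show "(\<Sum>e\<in>layer n s. (\<Sum>v\<in>e. b x v)\<^sup>2) \<le> real n" if "x \<in> I" for x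
    proof -
      have "(\<Sum>v\<in>e. b x v)\<^sup>2 \<le> (r * (\<epsilon> * k))\<^sup>2" if e: "e \<in> layer n s" for e
      proof (rule power_mono)
        have in_e: "v \<in> {1..n}" if "v \<in> e" for v using e that by (auto simp: layer_def)
        then have "(\<Sum>v\<in>e. b x v) \<le> (\<Sum>v\<in>e. \<epsilon> * k)"
          using coord[OF \<open>x \<in> I\<close>] by (intro sum_mono) (auto simp: b_def)
        also have "\<dots> = s * (\<epsilon> * k)" using e by (simp add: layer_def)
        also have "\<dots> \<le> r * (\<epsilon> * k)" using s \<epsilon> by (intro mult_right_mono) auto
        finally show "(\<Sum>v\<in>e. b x v) \<le> r * (\<epsilon> * k)" .
        show "0 \<le> (\<Sum>v\<in>e. b x v)"
          using coord[OF \<open>x \<in> I\<close>] in_e by (intro sum_nonneg) (auto simp: b_def)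
      qed
      then have "(\<Sum>e\<in>layer n s. (\<Sum>v\<in>e. b x v)\<^sup>2) \<le> card (layer n s) * (r * (\<epsilon> * k))\<^sup>2"
        by (intro sum_bounded_above)
      also have "\<dots> \<le> real n ^ s * (r * (\<epsilon> * k))\<^sup>2"
        using card_layer_le[of n s] by (intro mult_right_mono) (auto simp flip: of_nat_power)
      also have "\<dots> = real n * (a * k * r)\<^sup>2"
      proof -
        have "s = Suc (s - 1)" using s by auto
        then have "real n ^ s = real n * real n ^ (s - 1)" by (metis power_Suc)
        moreover have "\<epsilon>\<^sup>2 = a\<^sup>2 / real n ^ (s - 1)" by (simp add: \<epsilon>_def power_divide)
        ultimately show ?thesis using n by (simp add: power_mult_distrib)
      qed
      also have "\<dots> \<le> real n * 1"
        using a by (intro mult_left_mono power_le_one) auto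
      finally show ?thesis by simp
    qed
    show "real (card {x \<in> I. norm2 n (\<lambda>v. t v - b x v) < R})
        \<le> (2 * exp 1) ^ n / real k ^ n * real (card I)" for t
    proof -
      have "norm2 n (\<lambda>v. t v - b x v) = norm2 n (\<lambda>v. t v - \<epsilon> * real (x v))" for x
        unfolding norm2_def by (rule L2_set_cong) (auto simp: b_def)
      then have "card {x \<in> I. norm2 n (\<lambda>v. t v - b x v) < R} \<le> card {x \<in> {1..n} \<rightarrow>\<^sub>E {..<k}.
          norm2 n (\<lambda>v. t v - \<epsilon> * real (x v)) < \<epsilon> * sqrt (n / (4 * real k))}"
        using R[unfolded \<epsilon>R] by (intro card_mono) (auto simp: I_def intro!: finite_PiE)
      then show ?thesis
        using card_grid_ball_le[OF k1 \<epsilon>, of n t] k1 by (simp add: cardI)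
    qed
    \<comment> \<open>All factors are \<open>n\<close>-th powers, so the choice of \<open>k\<close>
      makes the base at most \<open>\<delta>\<^sup>2\<close>, and n \<ge> 1 finishes.\<close>
    have "exp (real n) * ((2 * exp 1) ^ n / real k ^ n) = (2 * (exp 1)\<^sup>2 / k) ^ n"
      by (simp add: exp_of_nat_mult[of n 1, simplified] power_mult_distrib power_divide
          power2_eq_square)
    also have "\<dots> \<le> (\<delta>\<^sup>2) ^ n"
      using k k1 \<delta> by (intro power_mono) (auto simp: field_simps)
    also have "\<dots> \<le> \<delta>\<^sup>2"
      using \<delta> n power_decreasing[of 1 n "\<delta>\<^sup>2"] by (simp add: power_le_one)
    finally show "exp (real n) * ((2 * exp 1) ^ n / real k ^ n) \<le> \<delta>\<^sup>2" .
  qed (rule \<delta>)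
qed

section \<open>The maximum norm\<close>

text \<open>With c \<le> 1/2 the energy \<open>c\<^sup>2 * ln n\<close> is at most
  \<open>ln n / 2\<close>, so the second moment is at most \<open>sqrt n\<close> against
  \<open>n\<close> alternatives. The lower bound on \<open>n\<close> says exactly that
  \<open>1 / sqrt n \<le> \<delta>\<^sup>2\<close>.\<close>

lemma minimax_norm_inf_ge:
  assumes s: "s \<in> {2..r}" and n: "n \<ge> 2" "1 / \<delta> ^ 4 \<le> n" and \<delta>: "0 < \<delta>"
    and c: "0 < c" "c \<le> M" "c \<le> 1 / 2"
    and R: "R \<le> c / 2 * sqrt (ln n / real n ^ (s - 1))"
  shows "(INF est\<in>estimators r n. SUP \<beta>\<in>param_box n M.
      measure_pmf.prob (beta_model r n (B(s := \<beta>))) {H. norm_inf n (\<lambda>v. est H v - \<beta> v) \<ge> R}) \<ge> 1 - \<delta>"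
proof -
  define \<epsilon> where "\<epsilon> = c * sqrt (ln n / real n ^ (s - 1))"
  define b where "b j = restrict (\<lambda>v. if v = j then \<epsilon> else 0) {1..n}" for j
  have lnn: "0 < ln (real n)" using n by simp
  have \<epsilon>: "\<epsilon> > 0" using c n lnn by (simp add: \<epsilon>_def)
  have \<epsilon>M: "\<epsilon> \<le> M"
  proof -
    have "ln n \<le> real n" using n ln_le_minus_one[of "real n"] by simp
    also have "\<dots> = real n ^ 1" by simp
    also have "\<dots> \<le> real n ^ (s - 1)" using s n by (intro power_increasing) auto
    finally have "sqrt (ln n / real n ^ (s - 1)) \<le> 1" using n by simp
    then have "\<epsilon> \<le> c * 1" unfolding \<epsilon>_def using c by (intro mult_left_mono) auto
    then show ?thesis using c by simp
  qed
  show ?thesis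
  proof (rule minimax_risk_ge[OF s, where I = "{1..n}" and b = b and \<kappa> = "ln n / 2"
        and \<rho> = "1 / real n"])
    show "b j \<in> param_box n M" for j
      unfolding b_def using n \<epsilon> \<epsilon>M by (intro param_boxI) auto
    show "(\<Sum>e\<in>layer n s. (\<Sum>v\<in>e. b j v)\<^sup>2) \<le> ln n / 2" for j
    proof -
      have "(\<Sum>v\<in>e. b j v) = (if j \<in> e then \<epsilon> else 0)" if e: "e \<in> layer n s" for e
      proof -
        have "e \<subseteq> {1..n}" using e by (simp add: layer_def)
        moreover from this have "finite e" using finite_subset by blast
        ultimately have "(\<Sum>v\<in>e. b j v) = (\<Sum>v\<in>e. if v = j then \<epsilon> else 0)"
          by (intro sum.cong) (auto simp: b_def)
        then show ?thesis using \<open>finite e\<close> by simp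
      qed
      then have "(\<Sum>e\<in>layer n s. (\<Sum>v\<in>e. b j v)\<^sup>2) = (\<Sum>e\<in>layer n s. if j \<in> e then \<epsilon>\<^sup>2 else 0)"
        by (intro sum.cong) auto
      also have "\<dots> = card {e \<in> layer n s. j \<in> e} * \<epsilon>\<^sup>2"
        by (simp add: sum.If_cases Int_def)
      also have "\<dots> \<le> real n ^ (s - 1) * \<epsilon>\<^sup>2"
        using card_layer_containing_le[of s n j] s
        by (intro mult_right_mono) (auto simp flip: of_nat_power)
      also have "\<dots> = c\<^sup>2 * ln n"
        using n lnn by (simp add: \<epsilon>_def power_mult_distrib)
      also have "\<dots> \<le> (1 / 2) * ln n"
      proof (rule mult_right_mono)
        have "c\<^sup>2 \<le> (1 / 2)\<^sup>2" using c by (intro power_mono) auto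
        then show "c\<^sup>2 \<le> 1 / 2" by (simp add: power2_eq_square)
      qed (use lnn in auto)
      finally show ?thesis by simp
    qed
    show "real (card {j \<in> {1..n}. norm_inf n (\<lambda>v. t v - b j v) < R})
        \<le> 1 / real n * real (card {1..n})" for t
    proof -
      have near: "\<bar>t v - b j v\<bar> < \<epsilon> / 2" if "norm_inf n (\<lambda>v. t v - b j v) < R" "v \<in> {1..n}" for j v
      proof -
        have "\<bar>t v - b j v\<bar> \<le> norm_inf n (\<lambda>v. t v - b j v)"
          unfolding norm_inf_def using that(2) by (intro Max_ge) auto
        then show ?thesis using that(1) R by (simp add: \<epsilon>_def)
      qed
      \<comment> \<open>For distinct spikes, coordinate \<open>j\<close> of \<open>t\<close> would
        be closer than \<epsilon>/2 both to \<epsilon> and to 0.\<close>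
      have "j = j'" if "j \<in> {1..n}" "norm_inf n (\<lambda>v. t v - b j v) < R"
        "norm_inf n (\<lambda>v. t v - b j' v) < R" for j j'
        using near[OF that(2,1)] near[OF that(3,1)] that(1)
        by (cases "j = j'") (auto simp: b_def abs_if split: if_splits)
      then have "card {j \<in> {1..n}. norm_inf n (\<lambda>v. t v - b j v) < R} \<le> Suc 0"
        by (subst card_le_Suc0_iff_eq) auto
      then show ?thesis using n by simp
    qed
    have "exp (ln n / 2) * (1 / real n) = 1 / sqrt n"
    proof -
      have "exp (ln n / 2) = sqrt n"
        using n by (simp add: powr_half_sqrt[symmetric] powr_def)
      then show ?thesis using n by (simp add: field_simps)
    qed
    also have "\<dots> \<le> \<delta>\<^sup>2"
    proof -
      have "sqrt (1 / \<delta> ^ 4) \<le> sqrt n" using n by simp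
      moreover have "sqrt (1 / \<delta> ^ 4) = 1 / \<delta>\<^sup>2"
        by (rule real_sqrt_unique) (auto simp: power_divide)
      ultimately show ?thesis using \<delta> n by (simp add: field_simps)
    qed
    finally show "exp (ln n / 2) * (1 / real n) \<le> \<delta>\<^sup>2" .
  qed (use n \<delta> in auto)
qed

section \<open>Choice of the constants\<close>

theorem theorem2p2:
  fixes r :: nat and M \<delta> :: real
  assumes "r \<ge> 2" and "M > 0" and "0 < \<delta>" and "\<delta> < 1"
  shows "\<exists>C>0. \<forall>s\<in>{2..r}.
    (\<forall>n\<ge>1. \<forall>B. (\<forall>s'\<in>{2..r}. B s' \<in> param_box n M) \<longrightarrow>
       (INF est\<in>estimators r n. SUP \<beta>\<in>param_box n M.
          measure_pmf.prob (beta_model r n (B(s := \<beta>)))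
            {H. norm2 n (\<lambda>v. est H v - \<beta> v) \<ge> C * sqrt (1 / real n ^ (s - 2))})
       \<ge> 1 - \<delta>) \<and>
    (\<exists>n\<^sub>0. \<forall>n\<ge>n\<^sub>0. \<forall>B. (\<forall>s'\<in>{2..r}. B s' \<in> param_box n M) \<longrightarrow>
       (INF est\<in>estimators r n. SUP \<beta>\<in>param_box n M.
          measure_pmf.prob (beta_model r n (B(s := \<beta>)))
            {H. norm_inf n (\<lambda>v. est H v - \<beta> v) \<ge> C * sqrt (ln (real n) / real n ^ (s - 1))})
       \<ge> 1 - \<delta>)"
proof -
  define k where "k = nat \<lceil>2 * (exp 1)\<^sup>2 / \<delta>\<^sup>2\<rceil>"
  have k: "real k \<ge> 2 * (exp 1)\<^sup>2 / \<delta>\<^sup>2"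
    unfolding k_def by (rule real_nat_ceiling_ge)
  have "0 < 2 * (exp 1)\<^sup>2 / \<delta>\<^sup>2" using assms by simp
  with k have k0: "real k > 0" by linarith
  \<comment> \<open>The two terms are the box and the energy constraints; using \<open>r\<close> in
    place of \<open>s\<close> makes \<open>a\<close> serve all layers.\<close>
  define a where "a = min (M / k) (1 / (k * r))"
  have a: "0 < a" "a * k \<le> M" "a * k * r \<le> 1"
  proof -
    show "0 < a" using assms k0 by (simp add: a_def)
    have "a \<le> M / k" "a \<le> 1 / (k * r)" by (auto simp: a_def)
    then show "a * k \<le> M" "a * k * r \<le> 1"
      using k0 assms by (auto simp: field_simps)
  qed
  define c where "c = min M (1 / 2)"
  have c: "0 < c" "c \<le> M" "c \<le> 1 / 2" using assms by (auto simp: c_def)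
  define C where "C = min (a / sqrt (4 * real k)) (c / 2)"
  have C: "0 < C" "C \<le> a / sqrt (4 * real k)" "C \<le> c / 2"
    using a c k0 by (simp_all only: C_def min.cobounded1 min.cobounded2) simp
  \<comment> \<open>The 2 ensures that \<open>ln n\<close> is positive.\<close>
  define n\<^sub>0 where "n\<^sub>0 = max 2 (nat \<lceil>1 / \<delta> ^ 4\<rceil>)"
  have n0: "n \<ge> 2" "1 / \<delta> ^ 4 \<le> real n" if "n \<ge> n\<^sub>0" for n
    using that real_nat_ceiling_ge[of "1 / \<delta> ^ 4"] by (auto simp: n\<^sub>0_def)
  show ?thesis
  proof (intro exI[of _ C] conjI ballI allI impI exI[of _ n\<^sub>0] C(1))
    fix s n :: nat and B :: "nat \<Rightarrow> nat \<Rightarrow> real" assume s: "s \<in> {2..r}" and n: "1 \<le> n"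
    show "(INF est\<in>estimators r n. SUP \<beta>\<in>param_box n M.
        measure_pmf.prob (beta_model r n (B(s := \<beta>)))
          {H. norm2 n (\<lambda>v. est H v - \<beta> v) \<ge> C * sqrt (1 / real n ^ (s - 2))}) \<ge> 1 - \<delta>"
      by (rule minimax_norm2_ge[OF s n assms(3,4) k a]) (intro mult_right_mono C; simp)
  next
    fix s n :: nat and B :: "nat \<Rightarrow> nat \<Rightarrow> real" assume s: "s \<in> {2..r}" and n: "n\<^sub>0 \<le> n"
    show "(INF est\<in>estimators r n. SUP \<beta>\<in>param_box n M.
        measure_pmf.prob (beta_model r n (B(s := \<beta>)))
          {H. norm_inf n (\<lambda>v. est H v - \<beta> v) \<ge> C * sqrt (ln (real n) / real n ^ (s - 1))}) \<ge> 1 - \<delta>"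
      using n0[OF n]
      by (intro minimax_norm_inf_ge[OF s n0[OF n] assms(3) c] mult_right_mono C) simp
  qed
qed

end
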